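(* Let $P$ be a connected finite poset with at least two points and let $C\subseteq E(P)$ be a 4-crown of $P$ with $L(C)=\{a,b\}$, $U(C)=\{v,w\}$. The following are equivalent: (i) there exists a $C$-separating homomorphism $\phi:\mathfrak{F}(P)\to\mathfrak{C}$; (ii) there exists a $C$-separating homomorphism $\psi:\mathfrak{F}(P)\to\mathfrak{C}$ with $\psi(F)=S$ for all $S\in\mathcal{C}_3$ and all $F\in\mathcal{F}(P)_S$; (iii) there exists a $C$-separating homomorphism from $\mathfrak{F}(P)$ to $\mathfrak{C}_3$ with the property stated in (ii).
   Context: All posets are finite; subsets are identified with induced subposets. $L(P)$, $U(P)$: minimal and maximal points of $P$; $E(P)=L(P)\cup U(P)$. $[x,y]_P=\{z: x\leq_P z\leq_P y\}$. A crown is a subset whose comparability graph is a cycle; a 4-crown $D=\{a,b,v,w\}$ with $L(D)=\{a,b\}$, $U(D)=\{v,w\}$ is improper if $[a,v]_P\cap[b,w]_P\neq\emptyset$. $\mathcal{C}_{23}$: the subsets of $C$ with 2 or 3 elements which are connected as induced subposets of $C$ (the four comparable pairs and $abv,abw,avw,bvw$, where $xyz=\{x,y,z\}$). $\mathfrak{C}$: multigraph on $\mathcal{C}_{23}$ with an L-edge between $S,T$ (loops allowed) iff $L(C)\cap S\cap T\neq\emptyset$ and a U-edge iff $U(C)\cap S\cap T\neq\emptyset$. $\mathcal{C}_3=\{S\in\mathcal{C}_{23}:\#S=3\}$ and $\mathfrak{C}_3$ is the sub-multigraph induced by $\mathcal{C}_3$. $\mathcal{A},\mathcal{B},\mathcal{V},\mathcal{W}$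 are the sets of $S\in\mathcal{C}_{23}$ with $L(C)\cap S=\{a\}$, $L(C)\cap S=\{b\}$, $U(C)\cap S=\{v\}$, $U(C)\cap S=\{w\}$ respectively. $\mathcal{F}(P)$: the set of improper 4-crowns of $P$ contained in $E(P)$; for $S\in\mathcal{C}_3$, $\mathcal{F}(P)_S=\{F\in\mathcal{F}(P): S\subseteq F\}$. $\mathfrak{F}(P)$: multigraph on $\mathcal{F}(P)$ with L-edge between $F,G$ iff $L(P)\cap F\cap G\neq\emptyset$ and U-edge iff $U(P)\cap F\cap G\neq\emptyset$. A homomorphism from $\mathfrak{F}(P)$ to $\mathfrak{C}$ (resp. $\mathfrak{C}_3$) is a map $\mathcal{F}(P)\to\mathcal{C}_{23}$ (resp. $\to\mathcal{C}_3$) sending L-edges to L-edges and U-edges to U-edges. It is $C$-separating if there exist $x\neq x'$ in $L(P)$ and $y\neq y'$ in $U(P)$ with $\{x,x',y,y'\}=C$ such that for all $F\in\mathcal{F}(P)$: $x\in F\Rightarrow\phi(F)\notin\mathcal{A}$; $x'\in F\Rightarrow\phi(F)\notin\mathcal{B}$; $y\in F\Rightarrow\phi(F)\notin\mathcal{V}$; $y'\in F\Rightarrow\phi(F)\notin\mathcal{W}$. *)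

theory Defs
  imports Main "HOL-Library.FuncSet"
begin

text \<open>
  A poset is a carrier \<open>P\<close> with \<open>partial_order_on P r\<close>; \<open>(x, y) \<in> r\<close> means \<open>x \<le> y\<close>. A subset
  \<open>A \<subseteq> P\<close> stands for the induced subposet: the notions below only use
  \<open>r\<close> between points of the given set, so \<open>r\<close> need not be restricted explicitly.
\<close>

definition minimals :: "'a rel \<Rightarrow> 'a set \<Rightarrow> 'a set" where
  "minimals r A = {x \<in> A. \<forall>y\<in>A. (y, x) \<in> r \<longrightarrow> y = x}"

definition maximals :: "'a rel \<Rightarrow> 'a set \<Rightarrow> 'a set" where
  "maximals r A = {x \<in> A. \<forall>y\<in>A. (x, y) \<in> r \<longrightarrow> y = x}"

definition extremals :: "'a rel \<Rightarrow> 'a set \<Rightarrow> 'a set" where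
  "extremals r A = minimals r A \<union> maximals r A"

definition interval :: "'a rel \<Rightarrow> 'a set \<Rightarrow> 'a \<Rightarrow> 'a \<Rightarrow> 'a set" where
  "interval r A x y = {z \<in> A. (x, z) \<in> r \<and> (z, y) \<in> r}"

definition comparability_edges :: "'a rel \<Rightarrow> 'a set \<Rightarrow> 'a set set" where
  "comparability_edges r A = {{x, y} | x y. x \<in> A \<and> y \<in> A \<and> x \<noteq> y \<and> (x, y) \<in> r}"

definition connected_poset :: "'a rel \<Rightarrow> 'a set \<Rightarrow> bool" where
  "connected_poset r A \<longleftrightarrow>
     A \<noteq> {} \<and> (\<forall>x\<in>A. \<forall>y\<in>A. (x, y) \<in> {(u, u'). {u, u'} \<in> comparability_edges r A}\<^sup>*)"

definition is_cycle_graph :: "'a set \<Rightarrow> 'a set set \<Rightarrow> bool" where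
  "is_cycle_graph V E \<longleftrightarrow>
     (\<exists>xs. distinct xs \<and> length xs \<ge> 3 \<and> set xs = V \<and>
        E = {{xs ! i, xs ! (Suc i mod length xs)} | i. i < length xs})"

definition crown :: "'a rel \<Rightarrow> 'a set \<Rightarrow> 'a set \<Rightarrow> bool" where
  "crown r P D \<longleftrightarrow> D \<subseteq> P \<and> is_cycle_graph D (comparability_edges r D)"

definition four_crown :: "'a rel \<Rightarrow> 'a set \<Rightarrow> 'a set \<Rightarrow> bool" where
  "four_crown r P D \<longleftrightarrow> crown r P D \<and> card D = 4"

text \<open>
  The labelling of the points of \<open>D\<close> is immaterial: a point of \<open>[a, v] \<inter> [b, w]\<close> lies above both
  minimal and below both maximal points of \<open>D\<close>.
\<close>

definition improper :: "'a rel \<Rightarrow> 'a set \<Rightarrow> 'a set \<Rightarrow> bool" where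
  "improper r P D \<longleftrightarrow> four_crown r P D \<and>
     (\<exists>a b v w. D = {a, b, v, w} \<and> minimals r D = {a, b} \<and> maximals r D = {v, w} \<and>
        interval r P a v \<inter> interval r P b w \<noteq> {})"

text \<open>
  Multigraphs with two kinds of undirected edges (L-edges and U-edges), at most one of each kind
  between any two vertices; loops are allowed.
\<close>

record 'v LU_graph =
  vertices :: "'v set"
  L_edge :: "'v \<Rightarrow> 'v \<Rightarrow> bool"
  U_edge :: "'v \<Rightarrow> 'v \<Rightarrow> bool"

definition induced_LU_graph :: "'v LU_graph \<Rightarrow> 'v set \<Rightarrow> 'v LU_graph" where
  "induced_LU_graph G W =
     \<lparr>vertices = vertices G \<inter> W,
      L_edge = (\<lambda>S T. S \<in> W \<and> T \<in> W \<and> L_edge G S T),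
      U_edge = (\<lambda>S T. S \<in> W \<and> T \<in> W \<and> U_edge G S T)\<rparr>"

definition LU_hom :: "'u LU_graph \<Rightarrow> 'v LU_graph \<Rightarrow> ('u \<Rightarrow> 'v) \<Rightarrow> bool" where
  "LU_hom G H \<phi> \<longleftrightarrow> \<phi> \<in> vertices G \<rightarrow> vertices H \<and>
     (\<forall>F\<in>vertices G. \<forall>F'\<in>vertices G.
        (L_edge G F F' \<longrightarrow> L_edge H (\<phi> F) (\<phi> F')) \<and>
        (U_edge G F F' \<longrightarrow> U_edge H (\<phi> F) (\<phi> F')))"

text \<open>The multigraph on a family of subsets of \<open>Q\<close>, used for \<open>Q = C\<close> and for \<open>Q = P\<close>.\<close>

definition intersection_LU_graph :: "'a rel \<Rightarrow> 'a set \<Rightarrow> 'a set set \<Rightarrow> 'a set LU_graph" where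
  "intersection_LU_graph r Q \<S> =
     \<lparr>vertices = \<S>,
      L_edge = (\<lambda>S T. S \<in> \<S> \<and> T \<in> \<S> \<and> minimals r Q \<inter> S \<inter> T \<noteq> {}),
      U_edge = (\<lambda>S T. S \<in> \<S> \<and> T \<in> \<S> \<and> maximals r Q \<inter> S \<inter> T \<noteq> {})\<rparr>"

definition C23 :: "'a rel \<Rightarrow> 'a set \<Rightarrow> 'a set set" where
  "C23 r C = {S. S \<subseteq> C \<and> card S \<in> {2, 3} \<and> connected_poset r S}"

definition C3 :: "'a rel \<Rightarrow> 'a set \<Rightarrow> 'a set set" where
  "C3 r C = {S \<in> C23 r C. card S = 3}"

definition C_graph :: "'a rel \<Rightarrow> 'a set \<Rightarrow> 'a set LU_graph" where
  "C_graph r C = intersection_LU_graph r C (C23 r C)"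

definition C3_graph :: "'a rel \<Rightarrow> 'a set \<Rightarrow> 'a set LU_graph" where
  "C3_graph r C = induced_LU_graph (C_graph r C) (C3 r C)"

text \<open>
  \<open>C23_low r C p\<close> is \<open>\<A>\<close>, \<open>\<B>\<close> for \<open>p = a, b\<close>; \<open>C23_up r C p\<close> is \<open>\<V>\<close>, \<open>\<W>\<close> for \<open>p = v, w\<close>.
\<close>

definition C23_low :: "'a rel \<Rightarrow> 'a set \<Rightarrow> 'a \<Rightarrow> 'a set set" where
  "C23_low r C p = {S \<in> C23 r C. minimals r C \<inter> S = {p}}"

definition C23_up :: "'a rel \<Rightarrow> 'a set \<Rightarrow> 'a \<Rightarrow> 'a set set" where
  "C23_up r C p = {S \<in> C23 r C. maximals r C \<inter> S = {p}}"

definition improper_crowns :: "'a rel \<Rightarrow> 'a set \<Rightarrow> 'a set set" where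
  "improper_crowns r P = {F. improper r P F \<and> F \<subseteq> extremals r P}"

definition improper_crowns_over :: "'a rel \<Rightarrow> 'a set \<Rightarrow> 'a set \<Rightarrow> 'a set set" where
  "improper_crowns_over r P S = {F \<in> improper_crowns r P. S \<subseteq> F}"

definition F_graph :: "'a rel \<Rightarrow> 'a set \<Rightarrow> 'a set LU_graph" where
  "F_graph r P = intersection_LU_graph r P (improper_crowns r P)"

definition separating ::
  "'a rel \<Rightarrow> 'a set \<Rightarrow> 'a set \<Rightarrow> 'a \<Rightarrow> 'a \<Rightarrow> 'a \<Rightarrow> 'a \<Rightarrow> ('a set \<Rightarrow> 'a set) \<Rightarrow> bool" where
  "separating r P C a b v w \<phi> \<longleftrightarrow>
     (\<exists>x\<in>minimals r P. \<exists>x'\<in>minimals r P. \<exists>y\<in>maximals r P. \<exists>y'\<in>maximals r P.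
        x \<noteq> x' \<and> y \<noteq> y' \<and> {x, x', y, y'} = C \<and>
        (\<forall>F\<in>improper_crowns r P.
           (x \<in> F \<longrightarrow> \<phi> F \<notin> C23_low r C a) \<and>
           (x' \<in> F \<longrightarrow> \<phi> F \<notin> C23_low r C b) \<and>
           (y \<in> F \<longrightarrow> \<phi> F \<notin> C23_up r C v) \<and>
           (y' \<in> F \<longrightarrow> \<phi> F \<notin> C23_up r C w)))"

definition respects_C3 :: "'a rel \<Rightarrow> 'a set \<Rightarrow> 'a set \<Rightarrow> ('a set \<Rightarrow> 'a set) \<Rightarrow> bool" where
  "respects_C3 r P C \<psi> \<longleftrightarrow> (\<forall>S\<in>C3 r C. \<forall>F\<in>improper_crowns_over r P S. \<psi> F = S)"

end

theory Submission
  imports Defs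
begin

text \<open>
  Since \<open>C23_low r C a\<close> consists of the members of \<open>C23 r C\<close> missing \<open>b\<close>, and similarly for the
  other three families, a separating homomorphism becomes, after a relabelling of \<open>C\<close> sending
  \<open>a, b, v, w\<close> to \<open>x', x, y', y\<close>, one whose value at every \<open>F\<close> contains \<open>F \<inter> C\<close>. This property,
  like being a homomorphism, survives enlarging every value to a three-element subset of \<open>C\<close>,
  and it forces the value \<open>S\<close> at each \<open>F \<supseteq> S\<close> with \<open>S\<close> of size three.
\<close>

section \<open>Connectedness through comparabilities\<close>

lemma doubleton_in_comparability_edges:
  "{x, y} \<in> comparability_edges r A \<longleftrightarrow>
     x \<in> A \<and> y \<in> A \<and> x \<noteq> y \<and> ((x, y) \<in> r \<or> (y, x) \<in> r)"
  unfolding comparability_edges_def by (auto simp: doubleton_eq_iff)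

text \<open>The point \<open>m\<close> serves as a hub: any two points are joined by a path through
  it.\<close>

lemma connected_poset_if_comparable_to:
  assumes "m \<in> A" and "\<And>x. x \<in> A \<Longrightarrow> x \<noteq> m \<Longrightarrow> (m, x) \<in> r \<or> (x, m) \<in> r"
  shows "connected_poset r A"
proof -
  let ?G = "{(u, u'). {u, u'} \<in> comparability_edges r A}"
  have "(x, m) \<in> ?G\<^sup>* \<and> (m, x) \<in> ?G\<^sup>*" if "x \<in> A" for x
  proof (cases "x = m")
    case False
    then have "(x, m) \<in> ?G" "(m, x) \<in> ?G"
      using assms that by (auto simp: doubleton_in_comparability_edges)
    then show ?thesis by blast
  qed simp
  then show ?thesis
    unfolding connected_poset_def using \<open>m \<in> A\<close> by (blast intro: rtrancl_trans)
qed

text \<open>A path between two distinct points has a first edge, and that edge is a comparable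
  pair.\<close>

lemma connected_poset_obtains_related:
  assumes "connected_poset r A" and "card A \<ge> 2"
  obtains x y where "x \<in> A" "y \<in> A" "x \<noteq> y" "(x, y) \<in> r"
proof -
  let ?G = "{(u, u'). {u, u'} \<in> comparability_edges r A}"
  obtain p q where pq: "p \<in> A" "q \<in> A" "p \<noteq> q"
    using \<open>card A \<ge> 2\<close> by (meson card_2_iff' obtain_subset_with_card_n subsetD)
  then have "(p, q) \<in> ?G\<^sup>*"
    using assms(1) unfolding connected_poset_def by blast
  then obtain z where "(p, z) \<in> ?G"
    using \<open>p \<noteq> q\<close> by (meson converse_rtranclE)
  then show thesis
    using that by (auto simp: doubleton_in_comparability_edges)
qed

section \<open>Structure of 4-crowns\<close>

text \<open>Directions alternate around the 4-cycle: two consecutive edges pointing the same way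
  would, by transitivity, make a diagonal comparable. The direction of one edge thus fixes the
  others, and \<open>p, s\<close> become the lower level, \<open>q, t\<close> the upper one.\<close>

lemma four_crown_obtains_points:
  assumes "trans r" and "four_crown r P C"
  obtains p q s t where "C = {p, q, s, t}" "distinct [p, q, s, t]"
    "(p, q) \<in> r" "(s, q) \<in> r" "(p, t) \<in> r" "(s, t) \<in> r"
    "(p, s) \<notin> r" "(s, p) \<notin> r" "(q, t) \<notin> r" "(t, q) \<notin> r"
proof -
  from \<open>four_crown r P C\<close> obtain xs where xs: "distinct xs" "set xs = C"
    and edges: "comparability_edges r C =
      {{xs ! i, xs ! (Suc i mod length xs)} | i. i < length xs}"
    and "card C = 4"
    unfolding four_crown_def crown_def is_cycle_graph_def by blast
  then have "length xs = 4" using distinct_card by metis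
  then obtain p q s t where xs_eq: "xs = [p, q, s, t]"
    by (auto simp: eval_nat_numeral length_Suc_conv)
  have C: "C = {p, q, s, t}" and dist: "distinct [p, q, s, t]"
    using xs xs_eq by auto
  have "{{xs ! i, xs ! (Suc i mod length xs)} | i. i < length xs} =
      (\<lambda>i. {xs ! i, xs ! (Suc i mod length xs)}) ` {..<length xs}"
    by blast
  also have "{..<length xs} = {0, 1, 2, 3}"
    using \<open>length xs = 4\<close> by (auto simp: lessThan_nat_numeral)
  also have "(\<lambda>i. {xs ! i, xs ! (Suc i mod length xs)}) ` \<dots> = {{p, q}, {q, s}, {s, t}, {t, p}}"
    by (simp add: xs_eq)
  finally have edges': "comparability_edges r C = {{p, q}, {q, s}, {s, t}, {t, p}}"
    using edges by simp
  have comparable: "(x, y) \<in> r \<or> (y, x) \<in> r \<longleftrightarrow> {x, y} \<in> {{p, q}, {q, s}, {s, t}, {t, p}}"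
    if "x \<in> C" "y \<in> C" "x \<noteq> y" for x y
    unfolding edges'[symmetric] doubleton_in_comparability_edges using that by blast
  have related: "(p, q) \<in> r \<or> (q, p) \<in> r" "(q, s) \<in> r \<or> (s, q) \<in> r"
    "(s, t) \<in> r \<or> (t, s) \<in> r" "(t, p) \<in> r \<or> (p, t) \<in> r"
    using comparable[of p q] comparable[of q s] comparable[of s t] comparable[of p t] dist
    by (auto simp: C)
  have unrelated: "(p, s) \<notin> r" "(s, p) \<notin> r" "(q, t) \<notin> r" "(t, q) \<notin> r"
    using comparable[of p s] comparable[of q t] dist
    by (auto simp: C doubleton_eq_iff)
  have trans: "(x, z) \<in> r" if "(x, y) \<in> r" "(y, z) \<in> r" for x y z
    using \<open>trans r\<close> that by (blast dest: transD)
  show thesis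
  proof (cases "(p, q) \<in> r")
    case True
    then have "(s, q) \<in> r" "(p, t) \<in> r" "(s, t) \<in> r"
      using related unrelated trans by metis+
    then show thesis using that[of p q s t] True C dist unrelated by blast
  next
    case False
    then have "(q, p) \<in> r" "(q, s) \<in> r" "(t, p) \<in> r" "(t, s) \<in> r"
      using related unrelated trans by metis+
    \<comment> \<open>Here \<open>q, t\<close> form the lower level, so the two diagonals exchange
      their roles.\<close>
    then show thesis using that[of q p t s] C dist unrelated by auto
  qed
qed

lemma four_crown_eq_minimals_un_maximals:
  assumes "trans r" and "four_crown r P C"
  shows "C = minimals r C \<union> maximals r C"
proof -
  from four_crown_obtains_points[OF assms] obtain p q s t
    where C: "C = {p, q, s, t}" "distinct [p, q, s, t]"
    and rel: "(p, q) \<in> r" "(s, q) \<in> r" "(p, t) \<in> r" "(s, t) \<in> r"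
      "(p, s) \<notin> r" "(s, p) \<notin> r" "(q, t) \<notin> r" "(t, q) \<notin> r" .
  \<comment> \<open>A reversed edge, composed with the other edge at the same upper point, would
    relate \<open>p\<close> and \<open>s\<close>.\<close>
  have "(q, p) \<notin> r" "(q, s) \<notin> r" "(t, p) \<notin> r" "(t, s) \<notin> r"
    using rel \<open>trans r\<close> by (metis transD)+
  then have "{p, s} \<subseteq> minimals r C" "{q, t} \<subseteq> maximals r C"
    using rel C unfolding minimals_def maximals_def by auto
  moreover have "minimals r C \<union> maximals r C \<subseteq> C"
    unfolding minimals_def maximals_def by blast
  ultimately show ?thesis using C(1) by blast
qed

text \<open>The remaining point on the level of \<open>z\<close> is comparable with both points of
  the other level, so it is a hub of \<open>C - {z}\<close>.\<close>

lemma four_crown_delete_in_C3: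
  assumes "trans r" and "four_crown r P C" and "z \<in> C"
  shows "C - {z} \<in> C3 r C"
proof -
  from four_crown_obtains_points[OF assms(1,2)] obtain p q s t
    where C: "C = {p, q, s, t}" "distinct [p, q, s, t]"
    and rel: "(p, q) \<in> r" "(s, q) \<in> r" "(p, t) \<in> r" "(s, t) \<in> r" .
  have "connected_poset r (C - {z})"
  proof (cases "z \<in> {p, s}")
    case True
    then show ?thesis
      by (intro connected_poset_if_comparable_to[where m = "if z = p then s else p"])
        (use C rel in auto)
  next
    case False
    then show ?thesis
      by (intro connected_poset_if_comparable_to[where m = "if z = q then t else q"])
        (use C rel assms(3) in auto)
  qed
  moreover have "card (C - {z}) = 3"
    using assms unfolding four_crown_def by simp
  ultimately show ?thesis
    unfolding C3_def C23_def by auto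
qed

text \<open>A connected set with at least two points contains a strict relation; its lower end is
  not maximal in \<open>C\<close>, hence minimal, and dually for its upper end. This is what turns
  avoiding \<open>C23_low r C a\<close> into containing \<open>b\<close>.\<close>

lemma C23_meets_extremals:
  assumes "C = minimals r C \<union> maximals r C" and "S \<in> C23 r C"
  shows "minimals r C \<inter> S \<noteq> {}" and "maximals r C \<inter> S \<noteq> {}"
proof -
  have S: "S \<subseteq> C" "connected_poset r S" "card S \<ge> 2"
    using assms(2) unfolding C23_def by auto
  obtain x y where xy: "x \<in> S" "y \<in> S" "x \<noteq> y" "(x, y) \<in> r"
    using connected_poset_obtains_related[OF S(2,3)] .
  then have "x \<notin> maximals r C" "y \<notin> minimals r C"
    using S(1) unfolding minimals_def maximals_def by auto
  then show "minimals r C \<inter> S \<noteq> {}" "maximals r C \<inter> S \<noteq> {}"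
    using assms(1) S(1) xy by blast+
qed

section \<open>Homomorphisms and values containing \<open>F \<inter> C\<close>\<close>

lemma C3_subset_C23: "C3 r C \<subseteq> C23 r C"
  unfolding C3_def by blast

lemma LU_hom_C_graph_iff:
  "LU_hom (F_graph r P) (C_graph r C) \<phi> \<longleftrightarrow>
     (\<forall>F\<in>improper_crowns r P. \<phi> F \<in> C23 r C) \<and>
     (\<forall>F\<in>improper_crowns r P. \<forall>G\<in>improper_crowns r P.
        (minimals r P \<inter> F \<inter> G \<noteq> {} \<longrightarrow> minimals r C \<inter> \<phi> F \<inter> \<phi> G \<noteq> {}) \<and>
        (maximals r P \<inter> F \<inter> G \<noteq> {} \<longrightarrow> maximals r C \<inter> \<phi> F \<inter> \<phi> G \<noteq> {}))"
  unfolding LU_hom_def F_graph_def C_graph_def intersection_LU_graph_def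
  by (simp add: Pi_iff cong: conj_cong ball_cong)

text \<open>An induced subgraph keeps every edge between its vertices, so only the condition on the
  values is strengthened.\<close>

lemma LU_hom_C3_graph_iff:
  "LU_hom (F_graph r P) (C3_graph r C) \<phi> \<longleftrightarrow>
     (\<forall>F\<in>improper_crowns r P. \<phi> F \<in> C3 r C) \<and> LU_hom (F_graph r P) (C_graph r C) \<phi>"
  unfolding LU_hom_def F_graph_def C3_graph_def C_graph_def induced_LU_graph_def
    intersection_LU_graph_def
  by (auto simp: Pi_iff subsetD[OF C3_subset_C23] cong: conj_cong ball_cong)

text \<open>If \<open>S\<close> lies in \<open>F\<close>, then it lies in
  \<open>F \<inter> C\<close> and so in \<open>\<psi> F\<close>; both have three elements.\<close>

lemma respects_C3_if_contains_trace:
  assumes "\<And>F. F \<in> improper_crowns r P \<Longrightarrow> \<psi> F \<in> C3 r C"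
    and "\<And>F. F \<in> improper_crowns r P \<Longrightarrow> F \<inter> C \<subseteq> \<psi> F"
  shows "respects_C3 r P C \<psi>"
  unfolding respects_C3_def
proof (intro ballI)
  fix S F
  assume S: "S \<in> C3 r C" and "F \<in> improper_crowns_over r P S"
  then have F: "F \<in> improper_crowns r P" "S \<subseteq> F"
    unfolding improper_crowns_over_def by auto
  have "S \<subseteq> C" "card S = 3" and "card (\<psi> F) = 3"
    using S assms(1)[OF F(1)] unfolding C3_def C23_def by auto
  moreover from this have "S \<subseteq> \<psi> F"
    using F assms(2) by blast
  moreover have "finite (\<psi> F)"
    using \<open>card (\<psi> F) = 3\<close> by (intro card_ge_0_finite) simp
  ultimately show "\<psi> F = S"
    by (metis card_subset_eq)
qed

text \<open>The roles of \<open>a, b\<close> and of \<open>v, w\<close> in \<^const>\<open>separating\<close> are interchanged: avoiding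
  \<^term>\<open>C23_low r C a\<close> amounts to containing \<open>b\<close>.\<close>

lemma separating_if_contains_trace:
  assumes "a \<in> minimals r P" "b \<in> minimals r P" "v \<in> maximals r P" "w \<in> maximals r P"
    and "a \<noteq> b" "v \<noteq> w"
    and "minimals r C = {a, b}" "maximals r C = {v, w}" "C = {a, b, v, w}"
    and "\<And>F. F \<in> improper_crowns r P \<Longrightarrow> F \<inter> C \<subseteq> \<psi> F"
  shows "separating r P C a b v w \<psi>"
proof -
  have "\<psi> F \<notin> C23_low r C a" if "b \<in> \<psi> F" for F
    using that assms(5,7) unfolding C23_low_def by auto
  moreover have "\<psi> F \<notin> C23_low r C b" if "a \<in> \<psi> F" for F
    using that assms(5,7) unfolding C23_low_def by auto
  moreover have "\<psi> F \<notin> C23_up r C v" if "w \<in> \<psi> F" for F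
    using that assms(6,8) unfolding C23_up_def by auto
  moreover have "\<psi> F \<notin> C23_up r C w" if "v \<in> \<psi> F" for F
    using that assms(6,8) unfolding C23_up_def by auto
  moreover have "z \<in> \<psi> F" if "F \<in> improper_crowns r P" "z \<in> F" "z \<in> {a, b, v, w}" for F z
    using assms(9,10) that by blast
  ultimately have "\<forall>F\<in>improper_crowns r P.
      (b \<in> F \<longrightarrow> \<psi> F \<notin> C23_low r C a) \<and> (a \<in> F \<longrightarrow> \<psi> F \<notin> C23_low r C b) \<and>
      (w \<in> F \<longrightarrow> \<psi> F \<notin> C23_up r C v) \<and> (v \<in> F \<longrightarrow> \<psi> F \<notin> C23_up r C w)"
    by auto
  moreover have "{b, a, w, v} = C"
    using assms(9) by auto
  ultimately show ?thesis
    unfolding separating_def using assms(1-6) by metis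
qed

section \<open>Relabelling and enlarging a separating homomorphism\<close>

text \<open>This carries (i) to (iii). Whichever points witness the separation for
  \<open>\<phi>\<close>, the one for \<open>\<psi>\<close> is witnessed by
  \<open>b, a, w, v\<close>.\<close>

lemma separating_LU_hom_to_C3:
  assumes "trans r" and "four_crown r P C"
    and min: "minimals r C = {a, b}" and max: "maximals r C = {v, w}"
    and hom: "LU_hom (F_graph r P) (C_graph r C) \<phi>"
    and "separating r P C a b v w \<phi>"
  obtains \<psi> where "LU_hom (F_graph r P) (C3_graph r C) \<psi>"
    and "separating r P C a b v w \<psi>" and "respects_C3 r P C \<psi>"
proof -
  let ?\<F> = "improper_crowns r P"
  have C_un: "C = minimals r C \<union> maximals r C"
    using four_crown_eq_minimals_un_maximals assms(1,2) .
  then have C: "C = {a, b, v, w}"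
    unfolding min max by blast
  have "card C = 4"
    using \<open>four_crown r P C\<close> unfolding four_crown_def by blast
  then have dist: "distinct [a, b, v, w]"
    using card_distinct[of "[a, b, v, w]"] C by simp
  from \<open>separating r P C a b v w \<phi>\<close> obtain x x' y y' where
    xy: "x \<in> minimals r P" "x' \<in> minimals r P" "y \<in> maximals r P" "y' \<in> maximals r P"
      "x \<noteq> x'" "y \<noteq> y'" "{x, x', y, y'} = C"
    and avoid: "\<forall>F\<in>?\<F>.
      (x \<in> F \<longrightarrow> \<phi> F \<notin> C23_low r C a) \<and> (x' \<in> F \<longrightarrow> \<phi> F \<notin> C23_low r C b) \<and>
      (y \<in> F \<longrightarrow> \<phi> F \<notin> C23_up r C v) \<and> (y' \<in> F \<longrightarrow> \<phi> F \<notin> C23_up r C w)"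
    unfolding separating_def by (elim bexE conjE) (rule that)
  have "C \<subseteq> P"
    using \<open>four_crown r P C\<close> unfolding four_crown_def crown_def by blast
  \<comment> \<open>A point of \<open>C\<close> that is extremal in \<open>P\<close> stays so in
    \<open>C\<close>. Hence \<open>x, x'\<close> are \<open>a, b\<close> and \<open>y, y'\<close>
    are \<open>v, w\<close>, each pair in an unknown order.\<close>
  then have "x \<in> minimals r C" "x' \<in> minimals r C" "y \<in> maximals r C" "y' \<in> maximals r C"
    using xy unfolding minimals_def maximals_def by blast+
  then have low: "{x, x'} = {a, b}" and up: "{y, y'} = {v, w}"
    using xy(5,6) unfolding min max by auto
  have \<phi>: "\<phi> F \<in> C23 r C" if "F \<in> ?\<F>" for F
    using hom that unfolding LU_hom_C_graph_iff by blast
  have meets: "\<phi> F \<inter> {a, b} \<noteq> {}" "\<phi> F \<inter> {v, w} \<noteq> {}" if "F \<in> ?\<F>" for F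
    using C23_meets_extremals[OF C_un \<phi>[OF that]] unfolding min max by blast+
  \<comment> \<open>The value meets \<open>{a, b}\<close>, but not in \<open>{a}\<close>
    alone.\<close>
  have contains_b: "b \<in> \<phi> F" if "F \<in> ?\<F>" "x \<in> F" for F
    using avoid that meets(1)[OF that(1)] \<phi>[OF that(1)]
    unfolding C23_low_def min by blast
  have contains_a: "a \<in> \<phi> F" if "F \<in> ?\<F>" "x' \<in> F" for F
    using avoid that meets(1)[OF that(1)] \<phi>[OF that(1)]
    unfolding C23_low_def min by blast
  have contains_w: "w \<in> \<phi> F" if "F \<in> ?\<F>" "y \<in> F" for F
    using avoid that meets(2)[OF that(1)] \<phi>[OF that(1)]
    unfolding C23_up_def max by blast
  have contains_v: "v \<in> \<phi> F" if "F \<in> ?\<F>" "y' \<in> F" for F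
    using avoid that meets(2)[OF that(1)] \<phi>[OF that(1)]
    unfolding C23_up_def max by blast
  \<comment> \<open>Each point that a point of \<open>F\<close> forces into \<open>\<phi> F\<close>
    is sent to the point forcing it. On each level of \<open>C\<close> this is the identity or the
    swap.\<close>
  define \<pi> where "\<pi> = id(a := x', b := x, v := y', w := y)"
  then have \<pi>: "\<pi> a = x'" "\<pi> b = x" "\<pi> v = y'" "\<pi> w = y"
    using dist by auto
  have trace: "F \<inter> C \<subseteq> \<pi> ` \<phi> F" if F: "F \<in> ?\<F>" for F
  proof -
    have "x \<in> F \<Longrightarrow> \<pi> b \<in> \<pi> ` \<phi> F" "x' \<in> F \<Longrightarrow> \<pi> a \<in> \<pi> ` \<phi> F"
      "y \<in> F \<Longrightarrow> \<pi> w \<in> \<pi> ` \<phi> F" "y' \<in> F \<Longrightarrow> \<pi> v \<in> \<pi> ` \<phi> F"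
      using F by (simp_all add: contains_a contains_b contains_v contains_w)
    then show ?thesis
      unfolding \<pi> xy(7)[symmetric] by blast
  qed
  have \<pi>_low: "\<pi> z \<in> {a, b}" if "z \<in> {a, b}" for z
    using that \<pi> low by auto
  have \<pi>_up: "\<pi> z \<in> {v, w}" if "z \<in> {v, w}" for z
    using that \<pi> up by auto

  \<comment> \<open>The image has at most three points, so it misses some \<open>z\<close> of the
    four-point set \<open>C\<close> and fits into \<open>C - {z}\<close>.\<close>
  have "\<exists>T\<in>C3 r C. \<pi> ` \<phi> F \<subseteq> T" if "F \<in> ?\<F>" for F
  proof -
    have S: "\<phi> F \<subseteq> C" "card (\<phi> F) \<le> 3"
      using \<phi>[OF that] unfolding C23_def by auto
    have "finite (\<phi> F)"
      using S(1) C finite_subset by auto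
    then have "card (\<pi> ` \<phi> F) < card C"
      using card_image_le[of "\<phi> F" \<pi>] S(2) \<open>card C = 4\<close> by linarith
    then obtain z where "z \<in> C" "z \<notin> \<pi> ` \<phi> F"
      using card_mono \<open>finite (\<phi> F)\<close> by (meson finite_imageI leD subsetI)
    moreover have "\<pi> ` \<phi> F \<subseteq> C"
      using S(1) \<pi>_low \<pi>_up unfolding C by blast
    ultimately have "\<pi> ` \<phi> F \<subseteq> C - {z}" and "C - {z} \<in> C3 r C"
      using four_crown_delete_in_C3[OF assms(1,2)] by (simp_all add: subset_Diff_insert)
    then show ?thesis by (rule bexI)
  qed
  then obtain \<psi> where \<psi>: "\<And>F. F \<in> ?\<F> \<Longrightarrow> \<psi> F \<in> C3 r C"
    and image: "\<And>F. F \<in> ?\<F> \<Longrightarrow> \<pi> ` \<phi> F \<subseteq> \<psi> F"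
    by metis
  have trace': "F \<inter> C \<subseteq> \<psi> F" if "F \<in> ?\<F>" for F
    using trace image that by blast
  have hom_min: "\<forall>F\<in>?\<F>. \<forall>G\<in>?\<F>.
      minimals r P \<inter> F \<inter> G \<noteq> {} \<longrightarrow> {a, b} \<inter> \<phi> F \<inter> \<phi> G \<noteq> {}"
    and hom_max: "\<forall>F\<in>?\<F>. \<forall>G\<in>?\<F>.
      maximals r P \<inter> F \<inter> G \<noteq> {} \<longrightarrow> {v, w} \<inter> \<phi> F \<inter> \<phi> G \<noteq> {}"
    using hom unfolding LU_hom_C_graph_iff min max by simp_all
  \<comment> \<open>The enlargements for different \<open>F\<close> may be chosen independently:
    \<open>\<pi>\<close> maps a common point of \<open>\<phi> F\<close> and \<open>\<phi> G\<close>
    to a common point on the same level.\<close>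
  have "{a, b} \<inter> \<psi> F \<inter> \<psi> G \<noteq> {}"
    if FG: "F \<in> ?\<F>" "G \<in> ?\<F>" "minimals r P \<inter> F \<inter> G \<noteq> {}" for F G
  proof -
    obtain z where "z \<in> {a, b}" "z \<in> \<phi> F" "z \<in> \<phi> G"
      using hom_min[rule_format, OF FG] by blast
    then have "\<pi> z \<in> {a, b} \<inter> \<psi> F \<inter> \<psi> G"
      using \<pi>_low image FG(1,2) by blast
    then show ?thesis by blast
  qed
  moreover have "{v, w} \<inter> \<psi> F \<inter> \<psi> G \<noteq> {}"
    if FG: "F \<in> ?\<F>" "G \<in> ?\<F>" "maximals r P \<inter> F \<inter> G \<noteq> {}" for F G
  proof -
    obtain z where "z \<in> {v, w}" "z \<in> \<phi> F" "z \<in> \<phi> G"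
      using hom_max[rule_format, OF FG] by blast
    then have "\<pi> z \<in> {v, w} \<inter> \<psi> F \<inter> \<psi> G"
      using \<pi>_up image FG(1,2) by blast
    then show ?thesis by blast
  qed
  ultimately have "LU_hom (F_graph r P) (C3_graph r C) \<psi>"
    unfolding LU_hom_C3_graph_iff LU_hom_C_graph_iff min max
    by (simp add: \<psi> subsetD[OF C3_subset_C23])
  moreover have "separating r P C a b v w \<psi>"
  proof (rule separating_if_contains_trace)
    show "a \<in> minimals r P" "b \<in> minimals r P" "v \<in> maximals r P" "w \<in> maximals r P"
      using xy(1-4) low up by (auto simp: doubleton_eq_iff)
  qed (use dist min max C trace' in auto)
  moreover have "respects_C3 r P C \<psi>"
    using \<psi> trace' by (rule respects_C3_if_contains_trace)
  ultimately show thesis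
    using that by blast
qed

theorem theorem3:
  fixes P C :: "'a set" and r :: "'a rel" and a b v w :: 'a
  assumes "finite P" and "partial_order_on P r"
    and "connected_poset r P" and "card P \<ge> 2"
    and "four_crown r P C" and "C \<subseteq> extremals r P"
    and "minimals r C = {a, b}" and "maximals r C = {v, w}"
  shows "((\<exists>\<phi>. LU_hom (F_graph r P) (C_graph r C) \<phi> \<and> separating r P C a b v w \<phi>)
          \<longleftrightarrow>
          (\<exists>\<psi>. LU_hom (F_graph r P) (C_graph r C) \<psi> \<and> separating r P C a b v w \<psi> \<and>
               respects_C3 r P C \<psi>))
       \<and> ((\<exists>\<psi>. LU_hom (F_graph r P) (C_graph r C) \<psi> \<and> separating r P C a b v w \<psi> \<and>
               respects_C3 r P C \<psi>)
          \<longleftrightarrow>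
          (\<exists>\<psi>. LU_hom (F_graph r P) (C3_graph r C) \<psi> \<and> separating r P C a b v w \<psi> \<and>
               respects_C3 r P C \<psi>))"
proof -
  have "trans r"
    using \<open>partial_order_on P r\<close> unfolding partial_order_on_def preorder_on_def by blast
  \<comment> \<open>The cycle is (i) to (iii) by the construction, (iii) to (ii) by the inclusion of
    \<open>C3_graph\<close> in \<open>C_graph\<close>, and (ii) to (i) by forgetting
    \<open>respects_C3\<close>.\<close>
  then show ?thesis
    using separating_LU_hom_to_C3[OF _ assms(5,7,8)] LU_hom_C3_graph_iff by metis
qed

end
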